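(* For all integers $n\geq 0$, $$pend(27n+10) \equiv pend(3n+1) \pmod{3}.$$
   Context: A PEND partition is an integer partition in which the even parts are not allowed to be distinct, i.e., no even part appears with multiplicity exactly one (every even part that occurs appears at least twice), while the odd parts are unrestricted. For an integer $n\geq 0$, $pend(n)$ denotes the number of PEND partitions of weight $n$, i.e., PEND partitions whose parts sum to $n$ (the empty partition is counted, so $pend(0)=1$). *)

theory Defs
  imports "HOL-Library.Multiset" "HOL-Number_Theory.Cong"
begin

text \<open>
  An integer partition is the multiset of its parts, which are positive integers;
  its weight is \<^term>\<open>\<Sum>\<^sub># P\<close>.
\<close>

definition integer_partition :: "nat multiset \<Rightarrow> bool" where
  "integer_partition P \<longleftrightarrow> (\<forall>k \<in># P. k > 0)"

definition pend_partition :: "nat multiset \<Rightarrow> bool" where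
  "pend_partition P \<longleftrightarrow> integer_partition P \<and> (\<forall>k \<in># P. even k \<longrightarrow> count P k \<noteq> 1)"

definition pend_partitions :: "nat \<Rightarrow> nat multiset set" where
  "pend_partitions n = {P. pend_partition P \<and> \<Sum>\<^sub># P = n}"

definition pend :: "nat \<Rightarrow> nat" where
  "pend n = card (pend_partitions n)"

text \<open>The sets being counted are finite, so \<^const>\<open>card\<close> is their true cardinality.\<close>

lemma size_le_sum_mset_if_pos:
  fixes P :: "nat multiset"
  assumes "\<forall>k \<in># P. k > 0"
  shows "size P \<le> \<Sum>\<^sub># P"
  using assms by (induction P) (auto simp: Suc_le_eq intro: add_less_le_mono)

lemma finite_pend_partitions: "finite (pend_partitions n)"
proof (rule finite_subset)
  show "pend_partitions n \<subseteq> (\<lambda>xs. mset xs) ` {xs. set xs \<subseteq> {..n} \<and> length xs \<le> n}"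
  proof
    fix P assume "P \<in> pend_partitions n"
    then have pos: "\<forall>k \<in># P. k > 0" and n: "\<Sum>\<^sub># P = n"
      by (auto simp: pend_partitions_def pend_partition_def integer_partition_def)
    obtain xs where xs: "mset xs = P"
      using ex_mset by blast
    have "set xs \<subseteq> {..n}"
      using n xs member_le_sum_list[of _ xs] by (auto simp flip: sum_mset_sum_list)
    moreover have "length xs \<le> n"
      using size_le_sum_mset_if_pos[OF pos] n xs by (metis size_mset)
    ultimately show "P \<in> (\<lambda>xs. mset xs) ` {xs. set xs \<subseteq> {..n} \<and> length xs \<le> n}"
      using xs by blast
  qed
  show "finite ((\<lambda>xs. mset xs) ` {xs. set xs \<subseteq> {..n} \<and> length xs \<le> n})"
    by (intro finite_imageI finite_lists_length_le) simp
qed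

lemma pend_0: "pend 0 = 1"
proof -
  have "pend_partitions 0 = {{#}}"
    by (auto simp: pend_partitions_def pend_partition_def integer_partition_def)
       (metis less_numeral_extra(3) multiset_nonemptyE)
  then show ?thesis
    by (simp add: pend_def)
qed

end

(*
  Write E_k = prod_(n >= 1) (1 - q^(kn)). The generating function of pend is
  E_2 E_12 / (E_1 E_4 E_6). Modulo 3 we have E_3k = E_k^3, and with Gauss's product
  psi(-q) = E_1 E_4 / E_2 the generating function becomes psi(-q)^2 / E_3. The dissection
  psi(q) = A(q^3) + q psi(q^9), where A(q) = E_2 E_3^2 / (E_1 E_6) by the Jacobi triple
  product, extracts the coefficients pend(3n+1): their generating function is
  C = E_2 E_4 E_6^3 / (E_3 E_12). Since E_2 E_4 = psi(q) psi(-q), the same dissection shows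
  that the coefficients of C at 3n have generating function psi(q) E_6^4 / E_12^2 and, in
  turn, those at 9n+3 have generating function psi(q^3) E_2^4 / E_4^2 = C modulo 3.
  All congruences are equalities of power series over the field with three elements.
*)
theory Submission
  imports Defs "HOL-Computational_Algebra.Formal_Laurent_Series"
begin

section \<open>Limits of formal power series\<close>

text \<open>Convergence of power series means that every coefficient is eventually constant.
  Coefficient \<open>n\<close> of a product involves only coefficients \<open>0..n\<close> of the
  factors, and these finitely many are eventually frozen together.\<close>

lemma tendsto_mult_fps:
  fixes f g :: "'b \<Rightarrow> 'a::comm_ring_1 fps"
  assumes "(f \<longlongrightarrow> a) F" and "(g \<longlongrightarrow> b) F"
  shows "((\<lambda>x. f x * g x) \<longlongrightarrow> a * b) F"
proof (rule tendsto_fpsI)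
  fix n
  have "\<forall>\<^sub>F x in F. \<forall>i\<in>{..n}. f x $ i = a $ i" "\<forall>\<^sub>F x in F. \<forall>i\<in>{..n}. g x $ i = b $ i"
    using assms by (auto simp: eventually_ball_finite_distrib tendsto_fps_iff)
  then show "\<forall>\<^sub>F x in F. (f x * g x) $ n = (a * b) $ n"
    by eventually_elim (simp add: fps_mult_nth)
qed

lemma tendsto_compose_fps:
  fixes f :: "'b \<Rightarrow> 'a::comm_ring_1 fps"
  assumes "(f \<longlongrightarrow> a) F"
  shows "((\<lambda>x. f x oo g) \<longlongrightarrow> a oo g) F"
proof (rule tendsto_fpsI)
  fix n
  have "\<forall>\<^sub>F x in F. \<forall>i\<in>{..n}. f x $ i = a $ i"
    using assms by (auto simp: eventually_ball_finite_distrib tendsto_fps_iff)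
  then show "\<forall>\<^sub>F x in F. (f x oo g) $ n = (a oo g) $ n"
    by eventually_elim (simp add: fps_compose_nth)
qed

lemma fps_X_power_dvd_iff:
  fixes f :: "'a::comm_ring_1 fps"
  shows "fps_X ^ n dvd f \<longleftrightarrow> (\<forall>i<n. f $ i = 0)"
proof
  assume "\<forall>i<n. f $ i = 0"
  then have "f = fps_X ^ n * fps_shift n f"
    by (auto simp: fps_eq_iff fps_X_power_mult_nth)
  then show "fps_X ^ n dvd f" by (rule dvdI)
qed (auto simp: fps_X_power_mult_nth elim!: dvdE)

text \<open>Convergence phrased as congruence modulo every power of X, a form in which error terms
  can be handled by divisibility rules.\<close>

lemma tendsto_fpsI_dvd:
  fixes f :: "'b \<Rightarrow> 'a::comm_ring_1 fps"
  assumes "\<And>n. \<forall>\<^sub>F x in F. fps_X ^ n dvd f x - a"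
  shows "(f \<longlongrightarrow> a) F"
proof (rule tendsto_fpsI)
  fix n
  show "\<forall>\<^sub>F x in F. f x $ n = a $ n"
    \<comment> \<open>Divisibility by X^n controls only the coefficients below \<open>n\<close>,
      hence \<open>Suc n\<close>.\<close>
    using assms[of "Suc n"] by eventually_elim (simp add: fps_X_power_dvd_iff del: power_Suc)
qed

lemma dvd_diff_mult:
  fixes a :: "'a::comm_ring_1"
  assumes "d dvd a - a'" and "d dvd b - b'"
  shows "d dvd a * b - a' * b'"
proof -
  have "a * b - a' * b' = (a - a') * b + a' * (b - b')" by (simp add: algebra_simps)
  then show ?thesis using assms by simp
qed

section \<open>Euler products\<close>

definition euler_prod :: "nat \<Rightarrow> nat \<Rightarrow> 'a::comm_ring_1 fps" where
  "euler_prod k N = (\<Prod>i<N. 1 - fps_X ^ (k * Suc i))"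

text \<open>The infinite product, read off along the diagonal: for \<open>k > 0\<close> all factors
  after the first \<open>n\<close> are 1 modulo X^(n+1), so coefficient \<open>n\<close> is final
  once \<open>n\<close> factors are present.\<close>

definition euler_fps :: "nat \<Rightarrow> 'a::comm_ring_1 fps" where
  "euler_fps k = Abs_fps (\<lambda>n. euler_prod k n $ n)"

lemma euler_prod_0 [simp]: "euler_prod k 0 = 1"
  by (simp add: euler_prod_def)

lemma euler_prod_Suc:
  "euler_prod k (Suc N) = euler_prod k N * (1 - fps_X ^ (k * Suc N))"
  by (simp add: euler_prod_def)

lemma euler_prod_stable:
  assumes "k > 0" and "L \<le> M" and "M \<le> N"
  shows "fps_X ^ Suc L dvd euler_prod k N - (euler_prod k M :: 'a::comm_ring_1 fps)"
  using \<open>M \<le> N\<close>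
proof (induction N rule: dec_induct)
  case (step N)
  have "Suc L \<le> k * Suc N"
    using assms step by (metis Suc_le_mono le_trans mult_le_mono nat_mult_1 Suc_leI One_nat_def)
  then have "(fps_X :: 'a fps) ^ Suc L dvd euler_prod k N * fps_X ^ (k * Suc N)"
    by (intro dvd_mult le_imp_power_dvd)
  with step.IH have "(fps_X :: 'a fps) ^ Suc L dvd
      (euler_prod k N - euler_prod k M) - euler_prod k N * fps_X ^ (k * Suc N)"
    by (rule dvd_diff)
  then show ?case by (simp add: euler_prod_Suc algebra_simps)
qed simp

lemma euler_prod_dvd_diff:
  assumes "k > 0" and "L \<le> N"
  shows "fps_X ^ L dvd euler_prod k N - (euler_fps k :: 'a::comm_ring_1 fps)"
  unfolding fps_X_power_dvd_iff
proof (intro allI impI)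
  fix i assume "i < L"
  then have "fps_X ^ Suc i dvd euler_prod k N - (euler_prod k i :: 'a fps)"
    using assms by (intro euler_prod_stable) auto
  then show "(euler_prod k N - euler_fps k :: 'a fps) $ i = 0"
    by (simp add: fps_X_power_dvd_iff euler_fps_def del: power_Suc)
qed

lemma euler_prod_tendsto:
  assumes "k > 0"
  shows "euler_prod k \<longlonglongrightarrow> (euler_fps k :: 'a::comm_ring_1 fps)"
  by (rule tendsto_fpsI_dvd, rule eventually_mono[OF eventually_ge_at_top euler_prod_dvd_diff[OF assms]])

lemma euler_prod_tendsto_mult:
  assumes "k > 0" and "c > 0"
  shows "(\<lambda>N. euler_prod k (c * N)) \<longlonglongrightarrow> (euler_fps k :: 'a::comm_ring_1 fps)"
  using assms by (intro filterlim_compose[OF euler_prod_tendsto] mult_nat_left_at_top) auto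

lemma euler_prod_nth_0: "k > 0 \<Longrightarrow> euler_prod k N $ 0 = (1 :: 'a::comm_ring_1)"
  by (induction N) (auto simp: euler_prod_Suc)

lemma euler_fps_nth_0 [simp]: "euler_fps k $ 0 = (1 :: 'a::comm_ring_1)"
  by (simp add: euler_fps_def)

lemma euler_fps_nonzero [simp]: "euler_fps k \<noteq> (0 :: 'a::comm_ring_1 fps)"
  using euler_fps_nth_0[where 'a='a] by (metis fps_zero_nth zero_neq_one)

text \<open>In Pochhammer notation the next three products are (q^k; q^(2k))_N, (-q^k; q^(2k))_N and
  (-q^k; q^k)_N.\<close>

definition odd_prod :: "nat \<Rightarrow> nat \<Rightarrow> 'a::comm_ring_1 fps" where
  "odd_prod k N = (\<Prod>i<N. 1 - fps_X ^ (k * (2 * i + 1)))"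

definition plus_odd_prod :: "nat \<Rightarrow> nat \<Rightarrow> 'a::comm_ring_1 fps" where
  "plus_odd_prod k N = (\<Prod>i<N. 1 + fps_X ^ (k * (2 * i + 1)))"

definition plus_prod :: "nat \<Rightarrow> nat \<Rightarrow> 'a::comm_ring_1 fps" where
  "plus_prod k N = (\<Prod>i<N. 1 + fps_X ^ (k * Suc i))"

lemma prod_double_upto:
  fixes f :: "nat \<Rightarrow> 'a::comm_monoid_mult"
  shows "(\<Prod>i<2 * N. f i) = (\<Prod>i<N. f (2 * i)) * (\<Prod>i<N. f (2 * i + 1))"
  by (induction N) (simp_all add: ac_simps)

text \<open>Exponents are sorted into odd and even multiples of \<open>k\<close>.\<close>

lemma euler_prod_double:
  "euler_prod k (2 * N) = odd_prod k N * (euler_prod (2 * k) N :: 'a::comm_ring_1 fps)"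
  by (simp add: euler_prod_def odd_prod_def prod_double_upto mult.assoc mult.left_commute)

lemma one_plus_times_one_minus:
  "(1 + fps_X ^ (k * m)) * (1 - fps_X ^ (k * m)) = (1 - fps_X ^ (2 * k * m) :: 'a::comm_ring_1 fps)"
  by (simp add: algebra_simps flip: power_add mult_2)

lemma plus_odd_prod_mult:
  "plus_odd_prod k N * odd_prod k N = (odd_prod (2 * k) N :: 'a::comm_ring_1 fps)"
  unfolding plus_odd_prod_def odd_prod_def prod.distrib [symmetric] one_plus_times_one_minus ..

lemma plus_prod_mult:
  "plus_prod k N * euler_prod k N = (euler_prod (2 * k) N :: 'a::comm_ring_1 fps)"
  unfolding plus_prod_def euler_prod_def prod.distrib [symmetric] one_plus_times_one_minus ..

section \<open>Substitutions q -> q^c and q -> -q in Euler products\<close>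

lemma euler_prod_compose_X_power:
  assumes "c > 0"
  shows "euler_prod k N oo fps_X ^ c = (euler_prod (c * k) N :: 'a::idom fps)"
  unfolding euler_prod_def using assms
  by (simp add: fps_compose_prod_distrib fps_compose_sub_distrib
      fps_compose_power[symmetric] mult.assoc flip: power_mult del: mult_Suc_right)

lemma euler_fps_compose_X_power:
  assumes "c > 0" and "k > 0"
  shows "euler_fps k oo fps_X ^ c = (euler_fps (c * k) :: 'a::idom fps)"
proof (rule LIMSEQ_unique)
  show "(\<lambda>N. euler_prod k N oo fps_X ^ c) \<longlonglongrightarrow> (euler_fps k oo fps_X ^ c :: 'a fps)"
    using assms by (intro tendsto_compose_fps euler_prod_tendsto)
  show "(\<lambda>N. euler_prod k N oo fps_X ^ c) \<longlonglongrightarrow> (euler_fps (c * k) :: 'a fps)"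
    using assms by (simp add: euler_prod_compose_X_power euler_prod_tendsto)
qed

lemma euler_fps_compose_uminus_even:
  assumes "even k" and "k > 0"
  shows "euler_fps k oo (- fps_X) = (euler_fps k :: 'a::idom fps)"
proof (rule LIMSEQ_unique)
  have "(- fps_X) ^ (k * Suc i) = (fps_X ^ (k * Suc i) :: 'a fps)" for i
    using assms by (intro power_minus_even) simp
  moreover have "euler_prod k N oo (- fps_X) = (\<Prod>i<N. 1 - (- fps_X) ^ (k * Suc i) :: 'a fps)" for N
    by (simp add: euler_prod_def fps_compose_prod_distrib fps_compose_sub_distrib
      fps_compose_power[symmetric] del: mult_Suc_right)
  ultimately have "euler_prod k N oo (- fps_X) = (euler_prod k N :: 'a fps)" for N
    by (simp only: euler_prod_def)
  with assms show "(\<lambda>N. euler_prod k N oo (- fps_X)) \<longlonglongrightarrow> (euler_fps k :: 'a fps)"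
    by (simp add: euler_prod_tendsto)
  show "(\<lambda>N. euler_prod k N oo (- fps_X)) \<longlonglongrightarrow> (euler_fps k oo (- fps_X) :: 'a fps)"
    using assms by (intro tendsto_compose_fps euler_prod_tendsto)
qed

lemma euler_prod_compose_uminus:
  assumes "odd k"
  shows "euler_prod k (2 * N) oo (- fps_X) = plus_odd_prod k N * (euler_prod (2 * k) N :: 'a::idom fps)"
proof -
  have e: "(- fps_X) ^ (2 * k * Suc i) = (fps_X ^ (2 * k * Suc i) :: 'a fps)" for i
    by (simp only: power_mult power2_minus mult.assoc)
  have o: "(- fps_X) ^ (k * (2 * i + 1)) = (- (fps_X ^ (k * (2 * i + 1))) :: 'a fps)" for i
    using assms by (intro power_minus_odd) simp
  have "euler_prod k (2 * N) oo (- fps_X) =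
      (\<Prod>i<N. 1 - (- fps_X) ^ (k * (2 * i + 1))) * (\<Prod>i<N. 1 - (- fps_X) ^ (2 * k * Suc i) :: 'a fps)"
    unfolding euler_prod_double unfolding euler_prod_def odd_prod_def
    by (simp add: fps_compose_mult_distrib fps_compose_prod_distrib fps_compose_sub_distrib
      fps_compose_power[symmetric] del: mult_Suc_right)
  then show ?thesis
    unfolding e o by (simp only: plus_odd_prod_def euler_prod_def diff_minus_eq_add)
qed

text \<open>For odd \<open>k\<close>, replacing q by -q flips the sign exactly in the factors whose
  exponent is an odd multiple of \<open>k\<close>. Times the original odd factors these give
  (q^(2k); q^(4k)), which E_4k completes to E_2k; two more copies of E_2k come from the even
  multiples.\<close>

lemma euler_fps_compose_uminus:
  assumes "odd k"
  shows "(euler_fps k oo (- fps_X)) * euler_fps k * euler_fps (4 * k) = (euler_fps (2 * k) :: 'a::idom fps) ^ 3"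
proof (rule LIMSEQ_unique)
  have k: "k > 0" using assms by (rule odd_pos)
  \<comment> \<open>The lengths \<open>2 * N\<close>, \<open>2 * N\<close> and \<open>N\<close> make
    the identity exact at every finite stage.\<close>
  let ?f = "\<lambda>N. (euler_prod k (2 * N) oo (- fps_X)) * euler_prod k (2 * N) * (euler_prod (4 * k) N :: 'a fps)"
  show "?f \<longlonglongrightarrow> (euler_fps k oo (- fps_X)) * euler_fps k * euler_fps (4 * k)"
    using k by (intro tendsto_mult_fps tendsto_compose_fps euler_prod_tendsto_mult euler_prod_tendsto) auto
  have "?f N = euler_prod (2 * k) (2 * N) * (euler_prod (2 * k) N * euler_prod (2 * k) N)" for N
  proof -
    have "?f N = (plus_odd_prod k N * odd_prod k N) * euler_prod (2 * (2 * k)) N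
        * (euler_prod (2 * k) N * euler_prod (2 * k) N)"
      unfolding euler_prod_compose_uminus[OF assms]
      unfolding euler_prod_double[of k] by (simp add: mult_ac)
    also have "\<dots> = euler_prod (2 * k) (2 * N) * (euler_prod (2 * k) N * euler_prod (2 * k) N)"
      by (simp add: plus_odd_prod_mult euler_prod_double[of "2 * k"])
    finally show ?thesis .
  qed
  then show "?f \<longlonglongrightarrow> euler_fps (2 * k) ^ 3"
    unfolding power3_eq_cube using k
    by (simp only: mult.assoc)
       (intro tendsto_mult_fps euler_prod_tendsto_mult euler_prod_tendsto; simp)
qed

text \<open>Cubing is additive in characteristic 3, so each factor satisfies (1 - x)^3 = 1 -
  x^3.\<close>

lemma euler_fps_cube:
  assumes "k > 0" and char3: "(3 :: 'a::comm_ring_1) = 0"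
  shows "euler_fps (3 * k) = (euler_fps k :: 'a fps) ^ 3"
proof (rule LIMSEQ_unique)
  have "(3 :: 'a fps) = 0"
    using char3 by (metis fps_const_0_eq_0 numeral_fps_const)
  have "(1 - x) ^ 3 = 1 - x ^ 3" for x :: "'a fps"
  proof -
    have "(1 - x) ^ 3 = 1 - x ^ 3 - 3 * (x - x ^ 2)"
      by (simp add: algebra_simps power2_eq_square power3_eq_cube)
    then show ?thesis using \<open>(3 :: 'a fps) = 0\<close> by simp
  qed
  then have "euler_prod (3 * k) = (\<lambda>N. (euler_prod k N :: 'a fps) ^ 3)"
    unfolding euler_prod_def fun_eq_iff prod_power_distrib
    by (simp add: mult.assoc mult.commute[of _ 3] del: mult_Suc_right flip: power_mult)
  with assms show "(\<lambda>N. (euler_prod k N :: 'a fps) ^ 3) \<longlonglongrightarrow> euler_fps (3 * k)"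
    using euler_prod_tendsto[of "3 * k", where 'a='a] by simp
  show "(\<lambda>N. (euler_prod k N :: 'a fps) ^ 3) \<longlonglongrightarrow> euler_fps k ^ 3"
    unfolding power3_eq_cube using assms
    by (intro tendsto_mult_fps euler_prod_tendsto)
qed

section \<open>The Jacobi triple product\<close>

text \<open>Extending the reciprocals by \<open>0\<close> to negative indices makes the recurrence
  \<open>inverse_euler_prod_step\<close> hold at index \<open>0\<close> too, so that sums can be shifted freely.\<close>

definition inverse_euler_prod :: "nat \<Rightarrow> int \<Rightarrow> 'a::field fps" where
  "inverse_euler_prod k j = (if j < 0 then 0 else inverse (euler_prod k (nat j)))"

lemma euler_prod_times_inverse:
  assumes "k > 0" and "j \<ge> 0"
  shows "euler_prod k (nat j) * inverse_euler_prod k j = (1 :: 'a::field fps)"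
  using assms by (simp add: inverse_euler_prod_def euler_prod_nth_0 inverse_mult_eq_1')

lemma inverse_euler_prod_step:
  assumes "k > 0" and "j \<ge> 0"
  shows "inverse_euler_prod k (j - 1) =
    inverse_euler_prod k j * (1 - fps_X ^ (k * nat j) :: 'a::field fps)"
proof (cases "j = 0")
  case False
  let ?e = "euler_prod k (nat j - 1) :: 'a fps" and ?x = "1 - fps_X ^ (k * nat j) :: 'a fps"
  have j: "nat j = Suc (nat j - 1)" "nat (j - 1) = nat j - 1" using False assms by auto
  have "euler_prod k (nat j) = ?e * ?x"
    using euler_prod_Suc[of k "nat j - 1", where 'a='a] j by simp
  then have "?e * (inverse_euler_prod k j * ?x) = 1"
    using euler_prod_times_inverse[OF assms, where 'a='a] by (simp add: mult_ac)
  moreover have "?e * inverse_euler_prod k (j - 1) = 1"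
    using euler_prod_times_inverse[OF assms(1), of "j - 1", where 'a='a] False assms j by simp
  moreover have "?e \<noteq> 0" using calculation by auto
  ultimately show ?thesis by (metis mult_left_cancel)
qed (simp add: inverse_euler_prod_def)

text \<open>Products of two consecutive integers are even and nonnegative, so neither
  \<open>div\<close> nor \<open>nat\<close> loses anything.\<close>

definition theta_exp :: "nat \<Rightarrow> nat \<Rightarrow> int \<Rightarrow> nat" where
  "theta_exp r s j = nat ((int r * (j * (j + 1)) + int s * (j * (j - 1))) div 2)"

text \<open>This is Ramanujan's \<open>f(q\<^sup>r, q\<^sup>s)\<close>, i.e. the sum of \<open>q^(r j(j+1)/2 + s j(j-1)/2)\<close> over all
  integers \<open>j\<close>; in particular \<open>theta_fps 1 3\<close> is \<open>\<psi>(q)\<close>.\<close>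

definition theta_fps :: "nat \<Rightarrow> nat \<Rightarrow> 'a::comm_ring_1 fps" where
  "theta_fps r s = Abs_fps (\<lambda>n. of_nat (card {j. theta_exp r s j = n}))"

lemma int_mult_pred_nonneg: "(j::int) * (j - 1) \<ge> 0"
  by (cases "j \<ge> 1") (auto simp: mult_nonneg_nonneg mult_nonpos_nonpos)

lemma int_mult_succ_nonneg: "(j::int) * (j + 1) \<ge> 0"
  using int_mult_pred_nonneg[of "j + 1"] by (simp add: mult.commute)

lemma two_times_theta_exp:
  "2 * int (theta_exp r s j) = int r * (j * (j + 1)) + int s * (j * (j - 1))"
proof -
  have "int r * (j * (j + 1)) + int s * (j * (j - 1)) \<ge> 0"
    by (simp add: int_mult_pred_nonneg int_mult_succ_nonneg)
  moreover have "even (int r * (j * (j + 1)) + int s * (j * (j - 1)))" by simp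
  ultimately show ?thesis
    unfolding theta_exp_def by (metis dvd_mult_div_cancel int_nat_eq zero_le_numeral pos_imp_zdiv_nonneg_iff zero_less_numeral)
qed

lemma theta_exp_swap: "theta_exp s r (- j) = theta_exp r s j"
  by (simp add: theta_exp_def algebra_simps)

lemma theta_exp_0 [simp]: "theta_exp r s 0 = 0"
  by (simp add: theta_exp_def)

lemma theta_exp_succ:
  "int (theta_exp r s (j + 1)) = int (theta_exp r s j) + int r + int (r + s) * j"
  using two_times_theta_exp[of r s j] two_times_theta_exp[of r s "j + 1"]
  by (simp add: algebra_simps)

text \<open>Since \<open>r\<close> and \<open>s\<close> are at least 1, the exponent is at least
  j^2. Hence every exponent is attained finitely often, and only small \<open>\<bar>j\<bar>\<close>
  affect the low coefficients.\<close>

lemma abs_le_theta_exp: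
  assumes "r > 0" and "s > 0"
  shows "\<bar>j\<bar> \<le> int (theta_exp r s j)"
proof -
  have "1 * (j * (j + 1)) + 1 * (j * (j - 1)) \<le> int r * (j * (j + 1)) + int s * (j * (j - 1))"
    using assms by (intro add_mono mult_right_mono int_mult_pred_nonneg int_mult_succ_nonneg) auto
  then have "j * j \<le> int (theta_exp r s j)"
    using two_times_theta_exp[of r s j] by (simp add: algebra_simps)
  moreover have "\<bar>j\<bar> \<le> j * j"
    using int_mult_pred_nonneg[of j] int_mult_succ_nonneg[of j] by (simp add: algebra_simps abs_if)
  ultimately show ?thesis by linarith
qed

text \<open>Multiplied by \<open>euler_prod (r + s) (m + n)\<close>, the products of reciprocals become the Gaussian
  binomial coefficients of the usual finite form of the triple product.\<close>

definition theta_sum :: "nat \<Rightarrow> nat \<Rightarrow> nat \<Rightarrow> nat \<Rightarrow> 'a::field fps" where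
  "theta_sum r s m n = (\<Sum>j\<in>{- int n..int m}. inverse_euler_prod (r + s) (int n + j) *
     inverse_euler_prod (r + s) (int m - j) * fps_X ^ theta_exp r s j)"

lemma theta_sum_swap: "theta_sum s r n m = theta_sum r s m n"
  unfolding theta_sum_def
  by (rule sum.reindex_bij_witness[of _ uminus uminus])
     (auto simp: theta_exp_swap add.commute mult.commute)

text \<open>A q-Pascal rule. After the second sum is shifted by one, the two terms at
  \<open>j\<close> share a common factor with weights 1 - X^A and X^A (1 - X^B), which add up to 1 -
  X^(A+B); here A + B = k (m + n + 1) does not depend on \<open>j\<close>.\<close>

lemma theta_sum_Suc:
  assumes "r + s > 0"
  shows "(1 + fps_X ^ (r + (r + s) * m)) * theta_sum r s m n =
    (1 - fps_X ^ ((r + s) * Suc (m + n))) * (theta_sum r s (Suc m) n :: 'a::field fps)"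
proof -
  define k where "k = r + s"
  let ?q = "\<lambda>i. inverse_euler_prod k i :: 'a fps" and ?e = "theta_exp r s"
  let ?I = "{- int n..int (Suc m)}"
  have neg: "?q i = 0" if "i < 0" for i using that by (simp add: inverse_euler_prod_def)
  \<comment> \<open>The added term \<open>j = m + 1\<close> vanishes because its reciprocal has
    index -1.\<close>
  have 1: "theta_sum r s m n = (\<Sum>j\<in>?I. ?q (int n + j) * ?q (int m - j) * fps_X ^ ?e j)"
    unfolding theta_sum_def k_def[symmetric]
    by (rule sum.mono_neutral_left) (auto simp: neg)
  have "fps_X ^ (r + k * m) * theta_sum r s m n =
      (\<Sum>j\<in>{- int n..int m}. ?q (int n + j) * ?q (int m - j) * fps_X ^ (r + k * m + ?e j))"
    by (simp add: theta_sum_def k_def sum_distrib_left power_add mult_ac)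
  also have "\<dots> = (\<Sum>j\<in>{- int n + 1..int m + 1}. ?q (int n + j - 1) * ?q (int m + 1 - j)
      * fps_X ^ (r + k * m + ?e (j - 1)))"
    by (rule sum.reindex_bij_witness[of _ "\<lambda>j. j - 1" "\<lambda>j. j + 1"]) (auto simp: algebra_simps)
  \<comment> \<open>Likewise the term \<open>j = - n\<close> is 0, so both sums run over the same
    range.\<close>
  also have "\<dots> = (\<Sum>j\<in>?I. ?q (int n + j - 1) * ?q (int m + 1 - j) * fps_X ^ (r + k * m + ?e (j - 1)))"
    by (rule sum.mono_neutral_left) (auto simp: neg)
  finally have 2: "fps_X ^ (r + k * m) * theta_sum r s m n = \<dots>" .
  have "(1 + fps_X ^ (r + k * m)) * theta_sum r s m n = (\<Sum>j\<in>?I.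
      ?q (int n + j) * ?q (int m - j) * fps_X ^ ?e j +
      ?q (int n + j - 1) * ?q (int m + 1 - j) * fps_X ^ (r + k * m + ?e (j - 1)))"
    unfolding sum.distrib 1[symmetric] 2[symmetric] by (simp add: algebra_simps)
  also have "\<dots> = (\<Sum>j\<in>?I. (1 - fps_X ^ (k * Suc (m + n))) *
      (?q (int n + j) * ?q (int (Suc m) - j) * fps_X ^ ?e j))"
  proof (rule sum.cong[OF refl])
    fix j assume j: "j \<in> ?I"
    define A B where "A = k * nat (int m + 1 - j)" and "B = k * nat (int n + j)"
    have k: "k > 0" using assms by (simp add: k_def)
    have A: "int A = int k * (int m + 1 - j)" and B: "int B = int k * (int n + j)"
      using j by (simp_all add: A_def B_def)
    have "int (A + B) = int (k * Suc (m + n))"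
      unfolding of_nat_add A B by (simp add: algebra_simps)
    then have AB: "k * Suc (m + n) = A + B" by linarith
    have "int (r + k * m + ?e (j - 1)) = int (A + ?e j)"
      using theta_exp_succ[of r s "j - 1"] A by (simp add: k_def algebra_simps)
    then have e: "r + k * m + ?e (j - 1) = A + ?e j" by linarith
    have qa: "?q (int m - j) = ?q (int m + 1 - j) * (1 - fps_X ^ A)"
      using inverse_euler_prod_step[OF k, of "int m + 1 - j", where 'a='a] j by (simp add: A_def)
    have qb: "?q (int n + j - 1) = ?q (int n + j) * (1 - fps_X ^ B)"
      using inverse_euler_prod_step[OF k, of "int n + j", where 'a='a] j by (simp add: B_def)
    have Suc: "int (Suc m) - j = int m + 1 - j" by simp
    show "?q (int n + j) * ?q (int m - j) * fps_X ^ ?e j +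
      ?q (int n + j - 1) * ?q (int m + 1 - j) * fps_X ^ (r + k * m + ?e (j - 1)) =
      (1 - fps_X ^ (k * Suc (m + n))) * (?q (int n + j) * ?q (int (Suc m) - j) * fps_X ^ ?e j)"
      unfolding qa qb e AB Suc power_add by (simp add: algebra_simps)
  qed
  also have "\<dots> = (1 - fps_X ^ (k * Suc (m + n))) * theta_sum r s (Suc m) n"
    by (simp add: theta_sum_def k_def sum_distrib_left)
  finally show ?thesis by (simp add: k_def)
qed

lemma theta_sum_Suc_right:
  assumes "r + s > 0"
  shows "(1 + fps_X ^ (s + (r + s) * n)) * theta_sum r s m n =
    (1 - fps_X ^ ((r + s) * Suc (m + n))) * (theta_sum r s m (Suc n) :: 'a::field fps)"
  using theta_sum_Suc[of s r n m, where 'a='a] assms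
  by (simp add: theta_sum_swap[of s r] add.commute)

text \<open>Each recurrence step trades one new factor on the left for one new factor of
  \<open>euler_prod\<close>: first \<open>m\<close> grows with \<open>n = 0\<close>, then
  \<open>n\<close> grows.\<close>

lemma finite_jacobi_triple_product:
  assumes "r + s > 0"
  shows "(\<Prod>i<m. 1 + fps_X ^ (r + (r + s) * i)) * (\<Prod>i<n. 1 + fps_X ^ (s + (r + s) * i)) =
    euler_prod (r + s) (m + n) * (theta_sum r s m n :: 'a::field fps)"
proof (induction n)
  case 0
  show ?case
  proof (induction m)
    case 0
    show ?case by (simp add: theta_sum_def inverse_euler_prod_def)
  next
    case (Suc m)
    then show ?case
      using theta_sum_Suc[OF assms, of m 0, where 'a='a] 
      by (simp add: euler_prod_Suc mult_ac del: mult_Suc_right)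
  qed
next
  case (Suc n)
  then show ?case
    using theta_sum_Suc_right[OF assms, of n m, where 'a='a] 
    by (simp add: euler_prod_Suc mult_ac del: mult_Suc_right)
qed

lemma dvd_diff_trans:
  fixes a :: "'a::comm_ring_1"
  assumes "d dvd a - b" and "d dvd b - c"
  shows "d dvd a - c"
  using dvd_add[OF assms] by simp

lemma jacobi_triple_product_approx:
  assumes "r > 0" and "s > 0" and "2 * L \<le> N"
  shows "fps_X ^ L dvd (\<Prod>i<N. (1 + fps_X ^ (r + (r + s) * i)) * (1 + fps_X ^ (s + (r + s) * i)))
    * euler_fps (r + s) - (theta_fps r s :: 'a::field fps)"
proof -
  \<comment> \<open>Applied with \<open>p\<close>, \<open>q\<close> the Euler products of
    \<open>N + j\<close> and \<open>N - j\<close> factors and \<open>u\<close>, \<open>v\<close>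
    their reciprocals.\<close>
  have cancel: "(a - p * q) * (u * v * x) = a * u * v * x - x"
    if "p * u = 1" "q * v = 1" for a p q u v x :: "'a fps"
    using that by algebra
  define k where "k = r + s"
  have k: "k > 0" using assms by (simp add: k_def)
  let ?q = "\<lambda>i. inverse_euler_prod k i :: 'a fps" and ?e = "theta_exp r s"
  let ?I = "{- int N..int N}"
  let ?E = "euler_fps k :: 'a fps"
  have "(\<Prod>i<N. (1 + fps_X ^ (r + (r + s) * i)) * (1 + fps_X ^ (s + (r + s) * i))) * ?E =
      (\<Sum>j\<in>?I. euler_prod k (N + N) * ?E * ?q (int N + j) * ?q (int N - j) * fps_X ^ ?e j)"
    using finite_jacobi_triple_product[of r s N N, where 'a='a] assms
    unfolding prod.distrib theta_sum_def k_def by (simp add: sum_distrib_left sum_distrib_right mult_ac)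
  moreover have "fps_X ^ L dvd
      euler_prod k (N + N) * ?E * ?q (int N + j) * ?q (int N - j) * fps_X ^ ?e j - fps_X ^ ?e j"
    if j: "j \<in> ?I" for j
  \<comment> \<open>A term with exponent at least \<open>L\<close> is 0 modulo X^L. Otherwise
    \<open>\<bar>j\<bar> < L\<close>, and \<open>2 * L \<le> N\<close> gives all Euler products at
    least \<open>L\<close> factors; modulo X^L they agree, so the reciprocals cancel.\<close>
  proof (cases "L \<le> ?e j")
    case True
    then show ?thesis by (intro dvd_diff dvd_mult le_imp_power_dvd) auto
  next
    case False
    with abs_le_theta_exp[of r s j] assms have "\<bar>j\<bar> < int L" by linarith
    with assms have L: "L \<le> nat (int N + j)" "L \<le> nat (int N - j)" "nat (int N + j) \<le> N + N"
      using j by auto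
    let ?P = "euler_prod k (nat (int N + j)) :: 'a fps" and ?Q = "euler_prod k (nat (int N - j)) :: 'a fps"
    have "fps_X ^ L dvd euler_prod k (N + N) - ?P"
      using euler_prod_stable[OF k L(1) L(3), where 'a='a] by (metis dvd_trans le_imp_power_dvd le_SucI order_refl)
    moreover have "fps_X ^ L dvd ?E - ?Q"
      using euler_prod_dvd_diff[OF k L(2), where 'a='a] by (simp add: dvd_diff_commute)
    ultimately have "fps_X ^ L dvd euler_prod k (N + N) * ?E - ?P * ?Q"
      by (rule dvd_diff_mult)
    then have "fps_X ^ L dvd (euler_prod k (N + N) * ?E - ?P * ?Q) * (?q (int N + j) * ?q (int N - j) * fps_X ^ ?e j)"
      by (rule dvd_mult2)
    moreover have "?P * ?q (int N + j) = 1" "?Q * ?q (int N - j) = 1"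
      using j by (intro euler_prod_times_inverse k; simp)+
    then have "(euler_prod k (N + N) * ?E - ?P * ?Q) * (?q (int N + j) * ?q (int N - j) * fps_X ^ ?e j)
        = euler_prod k (N + N) * ?E * ?q (int N + j) * ?q (int N - j) * fps_X ^ ?e j - fps_X ^ ?e j"
      by (rule cancel)
    ultimately show ?thesis by simp
  qed
  then have "fps_X ^ L dvd
      (\<Sum>j\<in>?I. euler_prod k (N + N) * ?E * ?q (int N + j) * ?q (int N - j) * fps_X ^ ?e j - fps_X ^ ?e j)"
    by (rule dvd_sum)
  moreover have "fps_X ^ L dvd (\<Sum>j\<in>?I. fps_X ^ ?e j) - (theta_fps r s :: 'a fps)"
    unfolding fps_X_power_dvd_iff
  proof (intro allI impI)
    fix i assume "i < L"
    \<comment> \<open>Below degree \<open>L\<close> the truncated range already contains every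
      \<open>j\<close> with that exponent.\<close>
    have "- int N \<le> j \<and> j \<le> int N" if "?e j = i" for j
      using abs_le_theta_exp[OF assms(1,2), of j] that \<open>i < L\<close> assms(3) by linarith
    then have "?I \<inter> {j. ?e j = i} = {j. ?e j = i}" by auto
    moreover have "(\<Sum>j\<in>?I. (fps_X :: 'a fps) ^ ?e j) $ i = of_nat (card (?I \<inter> {j. ?e j = i}))"
      by (simp add: fps_sum_nth sum.If_cases eq_commute[of i])
    ultimately show "((\<Sum>j\<in>?I. fps_X ^ ?e j) - (theta_fps r s :: 'a fps)) $ i = 0"
      by (simp add: theta_fps_def)
  qed
  ultimately show ?thesis
    unfolding k_def[symmetric] sum_subtractf by (metis (no_types) dvd_diff_trans)
qed

lemma jacobi_triple_product:
  assumes "r > 0" and "s > 0"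
  shows "(\<lambda>N. (\<Prod>i<N. (1 + fps_X ^ (r + (r + s) * i)) * (1 + fps_X ^ (s + (r + s) * i)))
    * euler_fps (r + s)) \<longlonglongrightarrow> (theta_fps r s :: 'a::field fps)"
  by (rule tendsto_fpsI_dvd, rule eventually_mono[OF eventually_ge_at_top jacobi_triple_product_approx[OF assms]])

text \<open>Gauss's product for \<psi>(q). The residues 1 and 3 modulo 4 together give all odd
  exponents, so the triple product is (-q; q^2) E_4, and (-q; q^2) (q; q^2) = (q^2; q^4).\<close>

lemma theta_1_3_product: "theta_fps 1 3 * euler_fps 1 = (euler_fps 2 :: 'a::field fps) ^ 2"
proof -
  let ?f = "\<lambda>N. (\<Prod>i<N. (1 + fps_X ^ (1 + (1 + 3) * i)) * (1 + fps_X ^ (3 + (1 + 3) * i)))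
    * (euler_fps (1 + 3) :: 'a fps)"
  have "?f N = plus_odd_prod 1 (2 * N) * euler_fps 4" for N
  proof -
    have "1 * (2 * (2 * i) + 1) = 1 + (1 + 3) * i" "1 * (2 * (2 * i + 1) + 1) = 3 + (1 + 3) * i" for i :: nat
      by simp_all
    then show ?thesis
      unfolding plus_odd_prod_def prod_double_upto by (simp only: prod.distrib) simp
  qed
  moreover have "plus_odd_prod 1 (2 * N) * euler_fps 4 * euler_prod 1 (2 * (2 * N)) * euler_prod 4 (2 * N)
    = euler_prod 2 (2 * (2 * N)) * euler_prod 2 (2 * N) * (euler_fps 4 :: 'a fps)" for N
  proof -
    have "plus_odd_prod 1 (2 * N) * euler_fps 4 * euler_prod 1 (2 * (2 * N)) * euler_prod 4 (2 * N)
      = (plus_odd_prod 1 (2 * N) * odd_prod 1 (2 * N)) * euler_prod (2 * 2) (2 * N)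
        * euler_prod 2 (2 * N) * (euler_fps 4 :: 'a fps)"
      unfolding euler_prod_double[of 1] by (simp add: mult_ac)
    also have "\<dots> = euler_prod 2 (2 * (2 * N)) * euler_prod 2 (2 * N) * euler_fps 4"
      unfolding plus_odd_prod_mult euler_prod_double[of 2] by simp
    finally show ?thesis .
  qed
  ultimately have "?f N * euler_prod 1 (4 * N) * euler_prod 4 (2 * N)
      = euler_prod 2 (4 * N) * euler_prod 2 (2 * N) * euler_fps 4" for N
    by simp
  moreover have "(\<lambda>N. ?f N * euler_prod 1 (4 * N) * euler_prod 4 (2 * N))
      \<longlonglongrightarrow> theta_fps 1 3 * euler_fps 1 * euler_fps 4"
    by (intro tendsto_mult_fps jacobi_triple_product euler_prod_tendsto_mult) auto
  ultimately have "(\<lambda>N. euler_prod 2 (4 * N) * euler_prod 2 (2 * N) * euler_fps 4)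
      \<longlonglongrightarrow> theta_fps 1 3 * euler_fps 1 * (euler_fps 4 :: 'a fps)"
    by (simp only:)
  moreover have "(\<lambda>N. euler_prod 2 (4 * N) * euler_prod 2 (2 * N) * euler_fps 4)
      \<longlonglongrightarrow> euler_fps 2 * euler_fps 2 * (euler_fps 4 :: 'a fps)"
    by (intro tendsto_mult_fps euler_prod_tendsto_mult tendsto_const) auto
  ultimately have "theta_fps 1 3 * euler_fps 1 * euler_fps 4 = euler_fps 2 * euler_fps 2 * (euler_fps 4 :: 'a fps)"
    by (rule LIMSEQ_unique)
  then show ?thesis by (simp add: power2_eq_square)
qed

text \<open>The exponents 1 and 2 modulo 3 lack only the multiples of 3. Supplying these turns the
  product into (-q; q) = E_2 / E_1, at the cost of (-q^3; q^3) = E_6 / E_3.\<close>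

lemma theta_1_2_product:
  "theta_fps 1 2 * euler_fps 6 * euler_fps 1 = euler_fps 2 * (euler_fps 3 :: 'a::field fps) ^ 2"
proof -
  let ?f = "\<lambda>N. (\<Prod>i<N. (1 + fps_X ^ (1 + (1 + 2) * i)) * (1 + fps_X ^ (2 + (1 + 2) * i)))
    * (euler_fps (1 + 2) :: 'a fps)"
  have pp: "(\<Prod>i<N. (1 + fps_X ^ (1 + (1 + 2) * i)) * (1 + fps_X ^ (2 + (1 + 2) * i))) * plus_prod 3 N
      = (plus_prod 1 (3 * N) :: 'a fps)" for N
  proof (induction N)
    case (Suc N)
    have p: "plus_prod k (Suc M) = plus_prod k M * (1 + fps_X ^ (k * Suc M) :: 'a fps)" for k M
      by (simp add: plus_prod_def)
    have "plus_prod 1 (3 * Suc N) = plus_prod 1 (Suc (Suc (Suc (3 * N))))"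
      by (rule arg_cong[of _ _ "plus_prod 1"]) simp
    also have "\<dots> = plus_prod 1 (3 * N) * (1 + fps_X ^ (1 + (1 + 2) * N)) *
        (1 + fps_X ^ (2 + (1 + 2) * N)) * (1 + fps_X ^ (3 * Suc N) :: 'a fps)"
    proof -
      have "1 + (1 + 2) * N = 1 * Suc (3 * N)" "2 + (1 + 2) * N = 1 * Suc (Suc (3 * N))"
        "3 * Suc N = 1 * Suc (Suc (Suc (3 * N)))" by simp_all
      then show ?thesis by (simp only: p)
    qed
    finally show ?case
      unfolding prod.lessThan_Suc p[of 3] Suc.IH[symmetric] by (simp only: mult_ac)
  qed (simp add: plus_prod_def)
  have "?f N * euler_prod 6 N * euler_prod 1 (3 * N)
      = euler_prod 2 (3 * N) * (euler_fps 3 * (euler_prod 3 N :: 'a fps))" for N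
  proof -
    have "euler_fps (1 + 2) = (euler_fps 3 :: 'a fps)"
      by (rule arg_cong[of _ _ euler_fps]) simp
    moreover have "euler_prod 6 N = plus_prod 3 N * (euler_prod 3 N :: 'a fps)"
      using plus_prod_mult[of 3 N, where 'a='a] by simp
    ultimately have "?f N * euler_prod 6 N * euler_prod 1 (3 * N)
        = ((\<Prod>i<N. (1 + fps_X ^ (1 + (1 + 2) * i)) * (1 + fps_X ^ (2 + (1 + 2) * i))) * plus_prod 3 N)
          * euler_prod 1 (3 * N) * euler_fps 3 * (euler_prod 3 N :: 'a fps)"
      by (simp only: mult_ac)
    also have "\<dots> = euler_prod 2 (3 * N) * (euler_fps 3 * (euler_prod 3 N :: 'a fps))"
      unfolding pp plus_prod_mult by (simp add: mult_ac)
    finally show ?thesis .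
  qed
  moreover have "(\<lambda>N. ?f N * euler_prod 6 N * euler_prod 1 (3 * N))
      \<longlonglongrightarrow> theta_fps 1 2 * euler_fps 6 * euler_fps 1"
    by (intro tendsto_mult_fps jacobi_triple_product euler_prod_tendsto_mult euler_prod_tendsto) auto
  ultimately have "(\<lambda>N. euler_prod 2 (3 * N) * (euler_fps 3 * euler_prod 3 N))
      \<longlonglongrightarrow> theta_fps 1 2 * euler_fps 6 * (euler_fps 1 :: 'a fps)"
    by (simp only:)
  moreover have "(\<lambda>N. euler_prod 2 (3 * N) * (euler_fps 3 * euler_prod 3 N))
      \<longlonglongrightarrow> euler_fps 2 * (euler_fps 3 * (euler_fps 3 :: 'a fps))"
    by (intro tendsto_mult_fps euler_prod_tendsto_mult euler_prod_tendsto tendsto_const) auto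
  ultimately show ?thesis
    unfolding power2_eq_square by (rule LIMSEQ_unique)
qed

section \<open>The generating function of PEND partitions\<close>

definition pend_partitions_upto :: "nat \<Rightarrow> nat \<Rightarrow> nat multiset set" where
  "pend_partitions_upto N n = {P \<in> pend_partitions n. set_mset P \<subseteq> {..N}}"

definition pend_upto_fps :: "nat \<Rightarrow> 'a::comm_ring_1 fps" where
  "pend_upto_fps N = Abs_fps (\<lambda>n. of_nat (card (pend_partitions_upto N n)))"

definition pend_fps :: "'a::comm_ring_1 fps" where
  "pend_fps = Abs_fps (\<lambda>n. of_nat (pend n))"

text \<open>The exponent \<open>j\<close> is the total weight of the copies of \<open>k\<close>, not
  their number; \<open>j = k\<close> is the single copy forbidden for even \<open>k\<close>.\<close>

definition pend_part_fps :: "nat \<Rightarrow> 'a::comm_ring_1 fps" where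
  "pend_part_fps k = Abs_fps (\<lambda>j. if k dvd j \<and> (even k \<longrightarrow> j \<noteq> k) then 1 else 0)"

lemma finite_pend_partitions_upto: "finite (pend_partitions_upto N n)"
  unfolding pend_partitions_upto_def using finite_pend_partitions by simp

lemma pend_partitions_upto_0: "pend_partitions_upto 0 n = (if n = 0 then {{#}} else {})"
proof -
  have "P = {#}" if "P \<in> pend_partitions_upto 0 n" for P
  proof -
    have "\<forall>k\<in>#P. k > 0" "set_mset P \<subseteq> {..0}"
      using that by (simp_all add: pend_partitions_upto_def pend_partitions_def pend_partition_def
        integer_partition_def)
    then have "set_mset P = {}" by fastforce
    then show ?thesis by simp
  qed
  moreover have "{#} \<in> pend_partitions_upto 0 0"
    by (simp add: pend_partitions_upto_def pend_partitions_def pend_partition_def integer_partition_def)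
  moreover have "\<Sum>\<^sub># P = n" if "P \<in> pend_partitions_upto 0 n" for P
    using that by (simp add: pend_partitions_upto_def pend_partitions_def)
  ultimately show ?thesis by (auto; force)
qed

text \<open>All copies of the largest allowed part are split off; \<open>j\<close> is their total
  weight.\<close>

lemma pend_partitions_upto_Suc:
  "pend_partitions_upto (Suc N) n =
    (\<Union>j\<in>{j. j \<le> n \<and> Suc N dvd j \<and> (even (Suc N) \<longrightarrow> j \<noteq> Suc N)}.
      (\<lambda>P. P + replicate_mset (j div Suc N) (Suc N)) ` pend_partitions_upto N (n - j))"
  (is "?L = (\<Union>j\<in>?J. ?h j ` _)")
proof (intro equalityI subsetI)
  fix P assume P: "P \<in> ?L"
  define c where "c = count P (Suc N)"
  define Q where "Q = filter_mset (\<lambda>i. i \<noteq> Suc N) P"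
  have PQ: "P = Q + replicate_mset c (Suc N)"
    by (rule multiset_eqI) (auto simp: Q_def c_def)
  have sum: "\<Sum>\<^sub># Q + c * Suc N = n"
    using P by (subst (asm) PQ) (simp add: pend_partitions_upto_def pend_partitions_def)
  have "c * Suc N \<in> ?J"
  proof -
    have "c \<noteq> 1" if "even (Suc N)"
    proof
      assume "c = 1"
      then have "Suc N \<in># P" "count P (Suc N) = 1" by (auto simp: c_def simp flip: count_greater_zero_iff)
      then show False
        using P that by (auto simp: pend_partitions_upto_def pend_partitions_def pend_partition_def)
    qed
    then show ?thesis using sum by (auto simp del: mult_Suc_right)
  qed
  moreover have "Q \<in> pend_partitions_upto N (n - c * Suc N)"
    using P sum unfolding pend_partitions_upto_def pend_partitions_def pend_partition_def
      integer_partition_def by (fastforce simp: Q_def le_Suc_eq)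
  moreover have "P = ?h (c * Suc N) Q"
    using PQ by (metis nonzero_mult_div_cancel_right nat.distinct(1))
  ultimately show "P \<in> (\<Union>j\<in>?J. ?h j ` pend_partitions_upto N (n - j))" by blast
next
  fix P assume "P \<in> (\<Union>j\<in>?J. ?h j ` pend_partitions_upto N (n - j))"
  then obtain j Q where j: "j \<in> ?J" and Q: "Q \<in> pend_partitions_upto N (n - j)" and P: "P = ?h j Q"
    by blast
  obtain c where c: "j = Suc N * c" using j by (auto elim!: dvdE simp del: mult_Suc)
  have P: "P = Q + replicate_mset c (Suc N)" unfolding P c by (metis nonzero_mult_div_cancel_left nat.distinct(1))
  have "Suc N \<notin># Q" using Q by (auto simp: pend_partitions_upto_def)
  then have "count Q (Suc N) = 0" by (simp add: not_in_iff)
  moreover have "\<Sum>\<^sub># P = n"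
    using Q j c by (simp add: P pend_partitions_upto_def pend_partitions_def mult.commute)
  ultimately show "P \<in> ?L"
    using Q j unfolding P c pend_partitions_upto_def pend_partitions_def pend_partition_def
      integer_partition_def by (auto split: if_splits)
qed

text \<open>The union is disjoint because the multiplicity of \<open>Suc N\<close> recovers
  \<open>j\<close>, and adding a fixed multiset is injective.\<close>

lemma card_pend_partitions_upto_Suc:
  "card (pend_partitions_upto (Suc N) n) =
    (\<Sum>j\<in>{j. j \<le> n \<and> Suc N dvd j \<and> (even (Suc N) \<longrightarrow> j \<noteq> Suc N)}. card (pend_partitions_upto N (n - j)))"
proof -
  let ?J = "{j. j \<le> n \<and> Suc N dvd j \<and> (even (Suc N) \<longrightarrow> j \<noteq> Suc N)}"
  let ?h = "\<lambda>j P. P + replicate_mset (j div Suc N) (Suc N)"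
  have fin: "finite ?J" by (rule finite_subset[of _ "{..n}"]) auto
  have "count P (Suc N) = j div Suc N" if "P \<in> ?h j ` pend_partitions_upto N m" for P j m
  proof -
    obtain Q where Q: "Q \<in> pend_partitions_upto N m" "P = ?h j Q" using \<open>P \<in> _\<close> by blast
    then have "Suc N \<notin># Q" by (auto simp: pend_partitions_upto_def)
    then show ?thesis using Q by (simp add: not_in_iff)
  qed
  then have "\<forall>i\<in>?J. \<forall>j\<in>?J. i \<noteq> j \<longrightarrow>
      ?h i ` pend_partitions_upto N (n - i) \<inter> ?h j ` pend_partitions_upto N (n - j) = {}"
    by (metis (no_types, lifting) disjoint_iff dvd_div_eq_iff mem_Collect_eq)
  then have "card (pend_partitions_upto (Suc N) n) =
      (\<Sum>j\<in>?J. card (?h j ` pend_partitions_upto N (n - j)))"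
    unfolding pend_partitions_upto_Suc
    by (intro card_UN_disjoint fin) (auto simp: finite_pend_partitions_upto)
  also have "\<dots> = (\<Sum>j\<in>?J. card (pend_partitions_upto N (n - j)))"
    by (intro sum.cong refl card_image) (auto simp: inj_on_def)
  finally show ?thesis .
qed

lemma pend_upto_fps_0: "pend_upto_fps 0 = 1"
  by (auto simp: fps_eq_iff pend_upto_fps_def pend_partitions_upto_0)

lemma pend_upto_fps_Suc:
  "pend_upto_fps (Suc N) = pend_part_fps (Suc N) * (pend_upto_fps N :: 'a::comm_ring_1 fps)"
proof (rule fps_ext)
  fix n
  let ?J = "{j. j \<le> n \<and> Suc N dvd j \<and> (even (Suc N) \<longrightarrow> j \<noteq> Suc N)}"
  have "(pend_part_fps (Suc N) * pend_upto_fps N :: 'a fps) $ n = (\<Sum>j\<in>{0..n}.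
      if j \<in> ?J then of_nat (card (pend_partitions_upto N (n - j))) else 0)"
    unfolding fps_mult_nth by (rule sum.cong) (auto simp: pend_part_fps_def pend_upto_fps_def)
  also have "\<dots> = (\<Sum>j\<in>?J. of_nat (card (pend_partitions_upto N (n - j))))"
    by (rule sum.mono_neutral_cong_right) auto
  finally show "pend_upto_fps (Suc N) $ n = (pend_part_fps (Suc N) * pend_upto_fps N :: 'a fps) $ n"
    by (simp add: pend_upto_fps_def card_pend_partitions_upto_Suc)
qed

section \<open>Closed forms for the factor of a single part size\<close>

lemma pend_part_fps_odd:
  assumes "odd k"
  shows "pend_part_fps k * (1 - fps_X ^ k) = (1 :: 'a::comm_ring_1 fps)"
proof (rule fps_ext)
  fix n
  have "k dvd n - k \<longleftrightarrow> k dvd n" if "k \<le> n" using that by (metis dvd_minus_self not_le)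
  moreover have "k dvd n \<longleftrightarrow> n = 0" if "n < k" using that by (auto dest: dvd_imp_le)
  moreover have "k > 0" using assms by (rule odd_pos)
  ultimately show "(pend_part_fps k * (1 - fps_X ^ k)) $ n = (1 :: 'a fps) $ n"
    using assms by (auto simp: right_diff_distrib fps_X_power_mult_right_nth pend_part_fps_def)
qed

text \<open>Here \<open>1 + x\<^sup>2 + x\<^sup>3 + \<dots> = (1 + x\<^sup>3) / (1 - x\<^sup>2)\<close>.\<close>

lemma pend_part_fps_even:
  assumes "even k" and "k > 0"
  shows "pend_part_fps k * (1 - fps_X ^ (2 * k)) = (1 + fps_X ^ (3 * k) :: 'a::comm_ring_1 fps)"
proof (rule fps_ext)
  fix n
  show "(pend_part_fps k * (1 - fps_X ^ (2 * k))) $ n = (1 + fps_X ^ (3 * k) :: 'a fps) $ n"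
  proof (cases "k dvd n")
    case True
    then obtain t where t: "n = k * t" ..
    have *: "n < 2 * k \<longleftrightarrow> t < 2" "n = 3 * k \<longleftrightarrow> t = 3" "n = k \<longleftrightarrow> t = 1" "n = 0 \<longleftrightarrow> t = 0"
      using \<open>k > 0\<close> by (simp_all add: t mult.commute[of _ k])
    have "n - 2 * k = k * (t - 2)" by (simp add: t diff_mult_distrib2 mult.commute)
    moreover have "k * (t - 2) = k \<longleftrightarrow> t = 3" using \<open>k > 0\<close> by auto
    ultimately have **: "n - 2 * k = k \<longleftrightarrow> t = 3" "k dvd n - 2 * k" by simp_all
    \<comment> \<open>The coefficient at \<open>n = k * t\<close> is [t \<noteq> 1] minus, when t
      \<ge> 2, [t \<noteq> 3]; it is 1 for t = 0 and t = 3 and 0 otherwise.\<close>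
    have "t = 0 \<or> t = 1 \<or> t = 2 \<or> t = 3 \<or> t > 3" by linarith
    then show ?thesis
      using assms True
      by (auto simp: right_diff_distrib fps_X_power_mult_right_nth pend_part_fps_def * **)
  next
    case False
    then have "n \<noteq> 0" "n \<noteq> 3 * k" by (metis dvd_0_right, metis dvd_triv_right)
    moreover have "\<not> k dvd n - 2 * k" if "2 * k \<le> n"
      using False that by (metis dvd_diffD dvd_triv_right)
    ultimately show ?thesis
      using False by (auto simp: right_diff_distrib fps_X_power_mult_right_nth pend_part_fps_def)
  qed
qed

text \<open>Each step adds one odd and one even part size, \<open>2 * N + 1\<close> and
  \<open>2 * N + 2\<close>, so the closed forms for both parities apply once.\<close>

lemma pend_upto_fps_product:
  "pend_upto_fps (2 * N) * odd_prod 1 N * euler_prod 4 N = (plus_prod 6 N :: 'a::comm_ring_1 fps)"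
proof (induction N)
  case 0
  show ?case by (simp add: pend_upto_fps_0 odd_prod_def plus_prod_def)
next
  case (Suc N)
  let ?w = "pend_part_fps :: nat \<Rightarrow> 'a fps"
  have "pend_upto_fps (2 * Suc N) = ?w (2 * Suc N) * (?w (2 * N + 1) * pend_upto_fps (2 * N))"
    by (simp add: pend_upto_fps_Suc)
  moreover have "odd_prod 1 (Suc N) = odd_prod 1 N * (1 - fps_X ^ (2 * N + 1) :: 'a fps)"
    by (simp add: odd_prod_def)
  moreover have "euler_prod 4 (Suc N) = euler_prod 4 N * (1 - fps_X ^ (2 * (2 * Suc N)) :: 'a fps)"
    unfolding euler_prod_Suc by (simp add: mult.assoc[symmetric] del: mult_Suc_right)
  moreover have "plus_prod 6 (Suc N) = plus_prod 6 N * (1 + fps_X ^ (3 * (2 * Suc N)) :: 'a fps)"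
    by (simp add: plus_prod_def)
  moreover have "?w (2 * N + 1) * (1 - fps_X ^ (2 * N + 1)) = 1"
    by (rule pend_part_fps_odd) simp
  moreover have "?w (2 * Suc N) * (1 - fps_X ^ (2 * (2 * Suc N))) = 1 + fps_X ^ (3 * (2 * Suc N))"
    by (rule pend_part_fps_even) simp_all
  ultimately show ?case
    unfolding Suc.IH[symmetric] by (simp only: mult_ac mult_1)
qed

text \<open>No part of a partition of \<open>n\<close> exceeds \<open>n\<close>, so the bound is
  vacuous once \<open>N \<ge> n\<close>.\<close>

lemma pend_upto_fps_tendsto: "pend_upto_fps \<longlonglongrightarrow> (pend_fps :: 'a::comm_ring_1 fps)"
proof (rule tendsto_fpsI)
  fix n
  have "pend_partitions_upto N n = pend_partitions n" if "n \<le> N" for N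
  proof -
    have "k \<le> n" if "P \<in> pend_partitions n" "k \<in># P" for P k
      using that by (auto simp: pend_partitions_def dest!: multi_member_split)
    with \<open>n \<le> N\<close> show ?thesis by (auto simp: pend_partitions_upto_def intro: order_trans)
  qed
  then show "\<forall>\<^sub>F N in sequentially. pend_upto_fps N $ n = (pend_fps :: 'a fps) $ n"
    by (intro eventually_mono[OF eventually_ge_at_top[of n]])
       (simp add: pend_upto_fps_def pend_fps_def pend_def)
qed

text \<open>Multiplying the finite product by E_2 completes the odd factors to E_1, and multiplying
  by E_6 turns (-q^6; q^6) into E_12. The identity holds over every commutative ring; reduction
  modulo 3 comes later.\<close>

lemma pend_fps_eq:
  "pend_fps * euler_fps 1 * euler_fps 4 * euler_fps 6 = (euler_fps 2 * euler_fps 12 :: 'a::comm_ring_1 fps)"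
proof (rule LIMSEQ_unique)
  let ?f = "\<lambda>N. pend_upto_fps (2 * N) * euler_prod 1 (2 * N) * euler_prod 4 N * (euler_prod 6 N :: 'a fps)"
  show "?f \<longlonglongrightarrow> pend_fps * euler_fps 1 * euler_fps 4 * euler_fps 6"
    by (intro tendsto_mult_fps euler_prod_tendsto_mult euler_prod_tendsto
        filterlim_compose[OF pend_upto_fps_tendsto] mult_nat_left_at_top) auto
  have "?f N = euler_prod 2 N * euler_prod 12 N" for N
  proof -
    have "?f N = (pend_upto_fps (2 * N) * odd_prod 1 N * euler_prod 4 N) * euler_prod 6 N * euler_prod 2 N"
      unfolding euler_prod_double[of 1] by (simp add: mult_ac)
    then show ?thesis
      unfolding pend_upto_fps_product plus_prod_mult by (simp add: mult_ac)
  qed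
  then show "?f \<longlonglongrightarrow> euler_fps 2 * euler_fps 12"
    by (simp only:) (intro tendsto_mult_fps euler_prod_tendsto; simp)
qed

section \<open>Dissections modulo 3\<close>

lemma finite_theta_exp_eq:
  assumes "r > 0" and "s > 0"
  shows "finite {j. theta_exp r s j = n}"
proof (rule finite_subset)
  have "- int n \<le> j \<and> j \<le> int n" if "theta_exp r s j = n" for j
    using abs_le_theta_exp[OF assms, of j] that by linarith
  then show "{j. theta_exp r s j = n} \<subseteq> {- int n..int n}" by auto
qed simp

lemma theta_exp_1_3: "int (theta_exp 1 3 j) = 2 * j * j - j"
  using two_times_theta_exp[of 1 3 j] by (simp add: algebra_simps)

lemma two_times_theta_exp_1_2: "2 * int (theta_exp 1 2 j) = 3 * j * j - j"
  using two_times_theta_exp[of 1 2 j] by (simp add: algebra_simps)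

text \<open>The exponent of \<psi> is 2j^2 - j. It is divisible by 3 unless j = 1 modulo 3; for j =
  1 - 3i it equals 9 (2i^2 - i) + 1, which reproduces \<psi>(q^9).\<close>

lemma theta_1_3_dissection:
  "theta_fps 1 3 = (theta_fps 1 2 oo fps_X ^ 3) + fps_X * ((theta_fps 1 3 oo fps_X ^ 3) oo fps_X ^ 3 :: 'a::comm_ring_1 fps)"
proof (rule fps_ext)
  note One_nat_def [simp del]
  fix n
  \<comment> \<open>\<open>g\<close> enumerates the integers not congruent to 1 modulo 3 and \<open>h\<close> those congruent to 1.\<close>
  define g :: "int \<Rightarrow> int" where "g k = (if even k then 3 * (k div 2) else 3 * ((1 - k) div 2) - 1)" for k
  define h :: "int \<Rightarrow> int" where "h i = 1 - 3 * i" for i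
  let ?e = "theta_exp 1 3" and ?f = "theta_exp 1 2"
  have g: "?e (g k) = 3 * ?f k" for k
  proof -
    have "int (2 * ?e (g k)) = int (2 * (3 * ?f k))"
    proof (cases "even k")
      case True
      then obtain i where "k = 2 * i" ..
      then have "k = 2 * i" "g k = 3 * i" by (auto simp: g_def)
      then show ?thesis
        using two_times_theta_exp_1_2[of k] theta_exp_1_3[of "g k"] by (simp add: algebra_simps)
    next
      case False
      then obtain i where "k = 2 * i + 1" ..
      then have k: "k = 2 * i + 1" and gk: "g k = 3 * (- i) - 1" by (auto simp: g_def)
      show ?thesis
        using two_times_theta_exp_1_2[of k] theta_exp_1_3[of "g k"] unfolding gk unfolding k
        by (simp add: algebra_simps)
    qed
    then show ?thesis by linarith
  qed
  have h: "?e (h i) = 9 * ?e i + 1" for i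
  proof -
    have "int (?e (h i)) = int (9 * ?e i + 1)"
      using theta_exp_1_3[of i] theta_exp_1_3[of "h i"] by (simp add: h_def algebra_simps)
    then show ?thesis by linarith
  qed
  have "{j. ?e j = n} = g ` {k. 3 * ?f k = n} \<union> h ` {i. 9 * ?e i + 1 = n}"
  proof (intro equalityI subsetI)
    fix j assume j: "j \<in> {j. ?e j = n}"
    have "(\<exists>k. j = g k) \<or> (\<exists>i. j = h i)"
    proof -
      consider i where "j = 3 * i" | i where "j = 3 * i - 1" | i where "j = 1 - 3 * i"
        by atomize_elim presburger
      then show ?thesis
      proof cases
        case (1 i)
        then have "j = g (2 * i)" by (simp add: g_def)
        then show ?thesis by blast
      next
        case (2 i)
        then have "j = g (1 - 2 * i)" by (simp add: g_def)
        then show ?thesis by blast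
      qed (auto simp: h_def)
    qed
    then show "j \<in> g ` {k. 3 * ?f k = n} \<union> h ` {i. 9 * ?e i + 1 = n}"
      using j g h by auto
  qed (auto simp: g h)
  moreover have "inj g"
  proof (rule inj_on_inverseI)
    fix k
    \<comment> \<open>A left inverse: divisibility of \<open>g k\<close> by 3 reveals the parity of
      \<open>k\<close>.\<close>
    let ?r = "\<lambda>j :: int. if 3 dvd j then 2 * (j div 3) else 1 - 2 * ((j + 1) div 3)"
    show "?r (g k) = k"
    proof (cases "even k")
      case False
      then obtain i where "k = 2 * i + 1" ..
      then have "k = 2 * i + 1" "g k + 1 = 3 * (- i)" "\<not> 3 dvd g k" by (auto simp: g_def) presburger
      then show ?thesis by simp
    qed (auto simp: g_def)
  qed
  moreover have "inj h" by (auto simp: inj_def h_def)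
  moreover have "g ` {k. 3 * ?f k = n} \<inter> h ` {i. 9 * ?e i + 1 = n} = {}"
  proof -
    have "3 * a \<noteq> 1 - 3 * b" "3 * a - 1 \<noteq> 1 - 3 * b" for a b :: int
      by presburger+
    then have "g k \<noteq> h i" for k i by (simp add: g_def h_def)
    then show ?thesis by blast
  qed
  moreover have "finite {k. 3 * ?f k = n}"
    by (rule finite_subset[OF _ finite_theta_exp_eq[of 1 2 "n div 3"]]) auto
  moreover have "finite {i. 9 * ?e i + 1 = n}"
    by (rule finite_subset[OF _ finite_theta_exp_eq[of 1 3 "n div 9"]]) auto
  ultimately have card: "card {j. ?e j = n} = card {k. 3 * ?f k = n} + card {i. 9 * ?e i + 1 = n}"
    by (simp add: card_Un_disjoint card_image inj_on_subset)
  have f: "{k. 3 * ?f k = n} = (if 3 dvd n then {k. ?f k = n div 3} else {})"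
    by auto
  \<comment> \<open>This says that \<open>n\<close> is 1 modulo 9, as two successive divisions by 3
    to match the nested substitution of X^3.\<close>
  define div9 where "div9 \<longleftrightarrow> n > 0 \<and> 3 dvd n - 1 \<and> 3 dvd (n - 1) div 3"
  have e: "{i. 9 * ?e i + 1 = n} = (if div9 then {i. ?e i = (n - 1) div 3 div 3} else {})"
  proof -
    have "9 * m + 1 = n \<longleftrightarrow> div9 \<and> m = (n - 1) div 3 div 3" for m
    proof
      assume "div9 \<and> m = (n - 1) div 3 div 3"
      then have "n > 0" "n - 1 = 3 * ((n - 1) div 3)" "(n - 1) div 3 = 3 * m"
        unfolding div9_def by auto
      then show "9 * m + 1 = n" by linarith
    next
      assume "9 * m + 1 = n"
      then have "n > 0" "n - 1 = 3 * (3 * m)" by simp_all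
      then show "div9 \<and> m = (n - 1) div 3 div 3" by (simp add: div9_def)
    qed
    then show ?thesis by simp
  qed
  have "(theta_fps 1 2 oo fps_X ^ 3 :: 'a fps) $ n = of_nat (card {k. 3 * ?f k = n})"
    unfolding f by (simp add: theta_fps_def fps_nth_compose_X_power)
  moreover have "(fps_X * ((theta_fps 1 3 oo fps_X ^ 3) oo fps_X ^ 3) :: 'a fps) $ n =
      of_nat (card {i. 9 * ?e i + 1 = n})"
    unfolding e by (simp add: theta_fps_def fps_nth_compose_X_power div9_def)
  moreover have "theta_fps 1 3 $ n =
      (of_nat (card {k. 3 * ?f k = n}) + of_nat (card {i. 9 * ?e i + 1 = n}) :: 'a)"
    unfolding theta_fps_def by (simp only: fps_nth_Abs_fps card of_nat_add)
  ultimately show "theta_fps 1 3 $ n = ((theta_fps 1 2 oo fps_X ^ 3) +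
      fps_X * ((theta_fps 1 3 oo fps_X ^ 3) oo fps_X ^ 3 :: 'a fps)) $ n"
    by (simp only: fps_add_nth)
qed

section \<open>Extraction of coefficients in a residue class\<close>

definition multisection :: "nat \<Rightarrow> nat \<Rightarrow> 'a fps \<Rightarrow> 'a fps" where
  "multisection d i f = Abs_fps (\<lambda>n. f $ (d * n + i))"

text \<open>A factor that is a series in X^d preserves residue classes of exponents and so passes
  through the extraction.\<close>

lemma multisection_compose_mult:
  fixes f g :: "'a::comm_ring_1 fps"
  assumes "i < d"
  shows "multisection d i ((f oo fps_X ^ d) * g) = f * multisection d i g"
proof (rule fps_ext)
  fix n
  have "((f oo fps_X ^ d) * g) $ (d * n + i) =
      (\<Sum>l\<in>{0..d * n + i}. if d dvd l then f $ (l div d) * g $ (d * n + i - l) else 0)"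
    unfolding fps_mult_nth by (rule sum.cong) (auto simp: fps_nth_compose_X_power)
  also have "\<dots> = (\<Sum>l\<in>{l \<in> {0..d * n + i}. d dvd l}. f $ (l div d) * g $ (d * n + i - l))"
    by (rule sum.inter_filter[symmetric]) simp
  also have "\<dots> = (\<Sum>l\<in>{0..n}. f $ l * g $ (d * (n - l) + i))"
  proof (rule sum.reindex_bij_witness[of _ "\<lambda>l. d * l" "\<lambda>l. l div d"])
    fix l assume "l \<in> {l \<in> {0..d * n + i}. d dvd l}"
    then obtain m where m: "l = d * m" and "d * m \<le> d * n + i" by auto
    \<comment> \<open>Here \<open>i < d\<close> enters: the remainder cannot make room for another
      multiple of \<open>d\<close>.\<close>
    moreover from this have "m \<le> n" using assms
      by (metis add_less_cancel_left le_less_trans mult_Suc_right less_Suc_eq_le nat_mult_less_cancel1 add.commute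
          not_less_zero not_gr_zero)
    ultimately show "d * (l div d) = l" "l div d \<in> {0..n}"
      "f $ (l div d) * g $ (d * (n - l div d) + i) = f $ (l div d) * g $ (d * n + i - l)"
      using assms by (auto simp: right_diff_distrib')
  next
    fix l assume "l \<in> {0..n}"
    then show "d * l div d = l" "d * l \<in> {l \<in> {0..d * n + i}. d dvd l}"
      using assms by (auto simp: trans_le_add1)
  qed
  finally show "multisection d i ((f oo fps_X ^ d) * g) $ n = (f * multisection d i g) $ n"
    by (simp add: multisection_def fps_mult_nth)
qed

lemma multisection_3_dissection:
  fixes f g h :: "'a::comm_ring_1 fps"
  defines "F \<equiv> (f oo fps_X ^ 3) + fps_X * (g oo fps_X ^ 3) + fps_X ^ 2 * (h oo fps_X ^ 3)"
  shows "multisection 3 0 F = f" and "multisection 3 1 F = g"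
proof -
  \<comment> \<open>For \<open>n = 0\<close> the truncated differences would be divisible by 3, but
    there the shifted series contribute nothing anyway.\<close>
  have "\<not> 3 dvd 3 * n - Suc 0" "\<not> 3 dvd 3 * n - 2" if "n > 0" for n :: nat
    using that by presburger+
  then show "multisection 3 0 F = f"
    by (auto simp: F_def multisection_def fps_eq_iff fps_nth_compose_X_power fps_X_power_mult_nth)
  have "\<not> 3 dvd 3 * n + 1 - 2" if "n > 0" for n :: nat
    using that by presburger
  moreover have "\<not> 3 dvd Suc (3 * n)" for n :: nat by presburger
  ultimately show "multisection 3 1 F = g"
    by (auto simp: F_def multisection_def fps_eq_iff fps_nth_compose_X_power fps_X_power_mult_nth)
qed

text \<open>From the outermost extraction inwards the index runs n -> 3n+1 -> 9n+3 -> 27n+10.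
  \<open>C\<close> and \<open>D\<close> are the series after one and two extractions; all quotients
  are kept as products and nonzero factors cancelled.\<close>

lemma pend_fps_multisection:
  assumes char3: "(3 :: 'a::field) = 0"
  shows "multisection 3 1 (multisection 3 0 (multisection 3 1 pend_fps)) =
    multisection 3 1 (pend_fps :: 'a fps)"
proof -
  note One_nat_def [simp del]
  let ?V = "\<lambda>f :: 'a fps. f oo fps_X ^ 3" and ?s = "\<lambda>f :: 'a fps. f oo (- fps_X)"
  define E where "E = (euler_fps :: nat \<Rightarrow> 'a fps)"
  define P where "P = (pend_fps :: 'a fps)"
  define \<psi> where "\<psi> = (theta_fps 1 3 :: 'a fps)"
  define A where "A = (theta_fps 1 2 :: 'a fps)"
  define \<psi>' where "\<psi>' = ?s \<psi>"
  define A' where "A' = ?s A"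
  define C where "C = multisection 3 1 P"
  define D where "D = multisection 3 0 C"
  have [simp]: "E k \<noteq> 0" for k by (simp add: E_def)
  have three: "(3 :: 'a fps) = 0"
    using char3 by (metis fps_const_0_eq_0 numeral_fps_const)
  have E3: "E 3 = E 1 ^ 3" and E6: "E 6 = E 2 ^ 3" and E12: "E 12 = E 4 ^ 3"
    using euler_fps_cube[OF _ char3, of 1] euler_fps_cube[OF _ char3, of 2]
      euler_fps_cube[OF _ char3, of 4] by (simp_all add: E_def)
  have V: "?V (E 1) = E 3" "?V (E 2) = E 6" "?V (E 4) = E 12"
    using euler_fps_compose_X_power[of 3 1, where 'a='a] euler_fps_compose_X_power[of 3 2, where 'a='a]
      euler_fps_compose_X_power[of 3 4, where 'a='a] by (simp_all add: E_def)
  have V_mult: "?V (f * g) = ?V f * ?V g" and s_mult: "?s (f * g) = ?s f * ?s g" for f g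
    by (simp_all add: fps_compose_mult_distrib)
  have V_power: "?V (f ^ m) = ?V f ^ m" for f m
    by (rule fps_compose_power[symmetric]) simp
  have sE: "?s (E 2) = E 2" "?s (E 6) = E 6"
    by (simp_all add: E_def euler_fps_compose_uminus_even)
  have sE1: "?s (E 1) * E 1 * E 4 = E 2 ^ 3" and sE3: "?s (E 3) * E 3 * E 12 = E 6 ^ 3"
    using euler_fps_compose_uminus[of 1, where 'a='a] euler_fps_compose_uminus[of 3, where 'a='a]
    by (simp_all add: E_def)

  have \<psi>: "\<psi> * E 1 = E 2 ^ 2"
    using theta_1_3_product[where 'a='a] by (simp add: \<psi>_def E_def)
  have A: "A * E 6 * E 1 = E 2 * E 3 ^ 2"
    using theta_1_2_product[where 'a='a] by (simp add: A_def E_def)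
  \<comment> \<open>Put -q into the product for \<psi> and eliminate E_1(-q).\<close>
  have \<psi>': "\<psi>' * E 2 = E 1 * E 4"
  proof -
    have "\<psi>' * ?s (E 1) = E 2 ^ 2"
      using arg_cong[OF \<psi>, of ?s] by (simp add: s_mult sE power2_eq_square \<psi>'_def)
    then have "(\<psi>' * E 2) * E 2 ^ 2 = (E 1 * E 4) * E 2 ^ 2" using sE1 by algebra
    then show ?thesis by simp
  qed
  have A': "A' * E 6 * E 2 ^ 3 * E 3 ^ 2 * E 12 ^ 2 = E 2 * E 1 * E 4 * E 6 ^ 6"
  proof -
    have "A' * E 6 * ?s (E 1) = E 2 * ?s (E 3) ^ 2"
      using arg_cong[OF A, of ?s] by (simp add: s_mult sE power2_eq_square A'_def)
    then show ?thesis using sE1 sE3 by algebra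
  qed
  have dis: "\<psi> = ?V A + fps_X * ?V (?V \<psi>)"
    unfolding \<psi>_def A_def by (rule theta_1_3_dissection)
  \<comment> \<open>The substitutions q -> -q and q -> q^3 commute because (-q)^3 = -q^3; only the
    separate factor X changes sign.\<close>
  have dis': "\<psi>' = ?V A' - fps_X * ?V (?V \<psi>')"
  proof -
    have swap: "?s (?V f) = ?V (?s f)" for f :: "'a fps"
    proof -
      have "(- fps_X) ^ 3 = (- (fps_X ^ 3) :: 'a fps)" by simp
      then show ?thesis
        by (subst (1 2) fps_compose_assoc[symmetric]) (simp_all add: fps_compose_uminus fps_compose_power[symmetric])
    qed
    show ?thesis
      unfolding \<psi>'_def A'_def
      by (subst dis) (simp add: fps_compose_add_distrib s_mult swap)
  qed

  have P: "P * E 3 = \<psi>' ^ 2"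
  proof -
    have "P * E 1 * E 4 * E 6 = E 2 * E 12"
      using pend_fps_eq[where 'a='a] by (simp add: P_def E_def)
    then have "(P * E 3) * (E 1 * E 4 * E 6) = \<psi>' ^ 2 * (E 1 * E 4 * E 6)"
      using \<psi>' unfolding E3 E6 E12 by algebra
    then show ?thesis by simp
  qed
  have C: "C * E 1 = A' * ?V \<psi>'"
  proof -
    have "\<psi>' ^ 2 = ?V (A' * A') + fps_X * ?V (A' * ?V \<psi>') + fps_X ^ 2 * ?V (?V \<psi>' * ?V \<psi>')"
    proof -
      \<comment> \<open>The cross term of the square has coefficient -2, which is 1 - 3 and hence 1
        in characteristic 3.\<close>
      have "\<psi>' ^ 2 = ?V (A' * A') + fps_X * ?V (A' * ?V \<psi>') + fps_X ^ 2 * ?V (?V \<psi>' * ?V \<psi>')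
          - 3 * (fps_X * ?V A' * ?V (?V \<psi>'))"
        using arg_cong[OF dis', of "\<lambda>f. f ^ 2"] by (simp add: V_mult power2_eq_square algebra_simps)
      then show ?thesis using three by simp
    qed
    then have "multisection 3 1 (?V (E 1) * P) = A' * ?V \<psi>'"
      using P by (simp only: V multisection_3_dissection mult.commute)
    moreover have "multisection 3 1 (?V (E 1) * P) = E 1 * C"
      unfolding C_def by (rule multisection_compose_mult) simp
    ultimately show ?thesis by (simp only: mult.commute)
  qed
  have C_eta: "C * E 3 * E 12 = E 2 * E 4 * E 6 ^ 3"
  proof -
    have "?V \<psi>' * E 6 = E 3 * E 12"
      using arg_cong[OF \<psi>', of ?V] by (simp add: V_mult V)
    then have "(C * E 1) * (E 6 ^ 2 * E 2 ^ 3 * E 3 ^ 2 * E 12 ^ 2) = (E 2 * E 1 * E 4 * E 6 ^ 6) * (E 3 * E 12)"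
      unfolding A'[symmetric] C by (simp add: power2_eq_square mult_ac)
    moreover have "(C * E 1) * (E 6 ^ 2 * E 2 ^ 3 * E 3 ^ 2 * E 12 ^ 2)
        = (C * E 3 * E 12) * (E 1 * E 6 ^ 2 * E 2 ^ 3 * E 3 * E 12)"
      by algebra
    \<comment> \<open>One factor E_6 is set apart: it equals E_2^3 and completes the common factor
      to be cancelled.\<close>
    moreover have "(E 2 * E 1 * E 4 * E 6 ^ 6) * (E 3 * E 12)
        = (E 2 * E 4 * E 6 ^ 3) * (E 1 * E 6 ^ 2 * E 6 * E 3 * E 12)"
      by algebra
    ultimately have "(C * E 3 * E 12) * (E 1 * E 6 ^ 2 * E 2 ^ 3 * E 3 * E 12)
        = (E 2 * E 4 * E 6 ^ 3) * (E 1 * E 6 ^ 2 * E 6 * E 3 * E 12)"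
      by (rule box_equals)
    then show ?thesis by (simp add: E6[symmetric])
  qed
  have D: "D * E 1 * E 4 = E 2 ^ 3 * (A' * A)"
  proof -
    \<comment> \<open>The two product formulas give \<psi>(q) \<psi>(-q) = E_2 E_4, so the numerator
      of \<open>C\<close> inherits the dissections.\<close>
    have "E 2 * E 4 * E 1 * E 2 = (\<psi>' * \<psi>) * E 1 * E 2"
      using \<psi> \<psi>' by algebra
    then have "(E 2 * E 4) * (E 1 * E 2) = (\<psi>' * \<psi>) * (E 1 * E 2)"
      by (simp only: mult_ac)
    then have "C * E 3 * E 12 = (\<psi>' * \<psi>) * E 6 ^ 3"
      using C_eta by simp
    then have "?V (E 1 * E 4) * C = ?V (E 2 ^ 3) * (\<psi>' * \<psi>)"
      by (simp only: V_mult V_power V mult_ac)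
    \<comment> \<open>Multiply the two dissections; the component in residue class 0 is
      \<open>A' * A\<close>.\<close>
    moreover have "\<psi>' * \<psi> = ?V (A' * A) + fps_X * ?V (A' * ?V \<psi> - A * ?V \<psi>') + fps_X ^ 2 * ?V (- (?V \<psi>' * ?V \<psi>))"
      using arg_cong2[OF dis' dis, of "(*)"]
      by (simp add: V_mult fps_compose_sub_distrib fps_compose_uminus power2_eq_square algebra_simps)
    ultimately have "(E 1 * E 4) * D = E 2 ^ 3 * (A' * A)"
      using multisection_compose_mult[of 0 3 "E 1 * E 4" C] multisection_compose_mult[of 0 3 "E 2 ^ 3" "\<psi>' * \<psi>"]
      by (simp add: D_def multisection_3_dissection)
    then show ?thesis by (simp add: mult_ac)
  qed
  have D_eta: "D * E 12 ^ 2 = \<psi> * E 6 ^ 4"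
  proof -
    \<comment> \<open>The extra factor supplies the denominators of \<open>A\<close> and
      \<open>A'\<close>, so that both product formulas can be substituted.\<close>
    have "(D * E 12 ^ 2) * (E 1 ^ 2 * E 2 ^ 3 * E 4 * E 3 ^ 2 * E 6 ^ 2 * E 12 ^ 2) =
        (D * E 1 * E 4) * (E 6 * E 2 ^ 3 * E 3 ^ 2 * E 12 ^ 2) * (E 6 * E 1) * E 12 ^ 2"
      by algebra
    also have "\<dots> = E 2 ^ 3 * (A' * E 6 * E 2 ^ 3 * E 3 ^ 2 * E 12 ^ 2) * (A * E 6 * E 1) * E 12 ^ 2"
      unfolding D by (simp only: mult_ac)
    also have "\<dots> = (E 2 ^ 2) * (E 1 * E 2 ^ 3 * E 4 * E 3 ^ 2 * E 6 ^ 6 * E 12 ^ 2)"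
      unfolding A A' by algebra
    also have "\<dots> = (\<psi> * E 6 ^ 4) * (E 1 ^ 2 * E 2 ^ 3 * E 4 * E 3 ^ 2 * E 6 ^ 2 * E 12 ^ 2)"
      unfolding \<psi>[symmetric] by algebra
    finally have "(D * E 12 ^ 2) * (E 1 ^ 2 * E 2 ^ 3 * E 4 * E 3 ^ 2 * E 6 ^ 2 * E 12 ^ 2) = \<dots>" .
    then show ?thesis by simp
  qed
  have "multisection 3 1 D * E 4 ^ 2 = E 2 ^ 4 * ?V \<psi>"
  proof -
    have "?V (E 4 ^ 2) * D = ?V (E 2 ^ 4) * \<psi>"
      using D_eta by (simp only: V_power V mult_ac)
    moreover have "multisection 3 1 \<psi> = ?V \<psi>"
      using multisection_3_dissection(2)[of A "?V \<psi>" 0] dis by simp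
    ultimately show ?thesis
      using multisection_compose_mult[of 1 3 "E 4 ^ 2" D] multisection_compose_mult[of 1 3 "E 2 ^ 4" \<psi>]
      by (simp only: mult.commute)
  qed
  \<comment> \<open>The multiplier E_3 E_4 turns \<psi>(q^3) into E_6^2 and E_4^2 into E_4^3 = E_12,
    matching the formula for \<open>C\<close>.\<close>
  then have "multisection 3 1 D * (E 3 * E 4 ^ 3) = E 2 ^ 4 * E 4 * (?V \<psi> * E 3)"
    by algebra
  also have "?V \<psi> * E 3 = E 6 ^ 2"
    using arg_cong[OF \<psi>, of ?V] by (simp add: V_mult V power2_eq_square)
  also have "E 2 ^ 4 * E 4 * E 6 ^ 2 = E 2 * E 4 * E 6 ^ 3"
    unfolding E6 by algebra
  also have "\<dots> = C * (E 3 * E 4 ^ 3)"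
    using C_eta by (simp add: E12 mult_ac)
  finally show ?thesis by (simp add: C_def D_def P_def)
qed

theorem theorem4:
  fixes n :: nat
  shows "[pend (27 * n + 10) = pend (3 * n + 1)] (mod 3)"
proof -
  \<comment> \<open>\<open>finite_3\<close> serves as the field with three elements; equality of
    images of naturals there is congruence modulo its characteristic.\<close>
  have three: "(3 :: Enum.finite_3) = 0"
    by (simp add: numeral.simps plus_finite_3_def one_finite_3_def zero_finite_3_def)
  have "multisection 3 1 (multisection 3 0 (multisection 3 1 pend_fps)) $ n =
      multisection 3 1 (pend_fps :: Enum.finite_3 fps) $ n"
    by (simp only: pend_fps_multisection[OF three])
  then have "(of_nat (pend (27 * n + 10)) :: Enum.finite_3) = of_nat (pend (3 * n + 1))"
    by (simp add: multisection_def pend_fps_def algebra_simps)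
  moreover have "CHAR(Enum.finite_3) = 3"
  proof (rule CHAR_eq_posI)
    show "of_nat x \<noteq> (0 :: Enum.finite_3)" if "x > 0" "x < 3" for x
    proof -
      have "x = 1 \<or> x = 2" using that by linarith
      then show ?thesis by (auto simp: zero_finite_3_def)
    qed
  qed (simp_all add: three)
  ultimately show ?thesis
    by (simp add: of_nat_eq_iff_cong_CHAR)
qed

end
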